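(* Let $x$ be a formula such that, for every Q-structure and every assignment of facts to propositional letters, the element $1$ of the structure belongs to the interpretation of $x$. Then the sequent $\vdash x$ is derivable from the axioms and rules listed in the context.
   Context: A Q-structure is a tuple $\langle \mathcal P,\mathcal Z,\cdot,1\rangle$ where $\mathcal P$ is a set, $\mathcal Z\subseteq\mathcal P$, $\cdot$ is a binary operation on $\mathcal P$ (not assumed associative or commutative), and $1\in\mathcal P$. These satisfy, for all $x,y,z$: (a) $x\cdot y\in\mathcal Z$ iff $y\cdot x\in\mathcal Z$; (b) $(x\cdot y)\cdot z\in\mathcal Z$ iff $x\cdot(z\cdot y)\in\mathcal Z$; and $1\cdot x=x\cdot1=x$. For $A\subseteq\mathcal P$ let $A^\perp=\{b: b\cdot a\in\mathcal Z\ \forall a\in A\}$. A fact is a set $F$ with $F=(F^\perp)^\perp$. Let $A\cdot B=\{a\cdot b: a\in A,b\in B\}$. Operations on facts: - $\sim F=F^\perp$; - $F\otimes G=((F\cdot G)^\perp)^\perp$; - $F\wp G=(F^\perp\cdot G^\perp)^\perp$; - $F\&G=F\cap G$; - $F\oplus G=((F\cup G)^\perp)^\perp$. Formulas are built from propositional letters $a$, their negations $\sim a$, and the constants $\mathbf1,\top,\sim\mathbf1,\sim\top$, using $\otimes,\wp,\&,\oplus$. Negation of compound formulas is defined by De Morgan duality: $\sim(A\otimes B)=\sim A\wp\sim B$, $\sim(A\wp B)=\sim A\otimes\sim B$, $\sim(A\&B)=\sim A\oplus\sim B$, $\sim(A\oplus B)=\sim A\&\sim B$, and $\sim\sim A=A$.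 Given an assignment of facts to letters, formulas are interpreted as facts: $\mathbf1$ as $\mathcal Z^\perp$, $\top$ as $\mathcal P$, and the connectives by the operations above. Axioms and rules ($A,B,C,D$ formulas, $\sigma$ a finite sequence of formulas): - Logical axiom: $\vdash\sim A,A$. - Cut: from $\vdash A,B$ and $\vdash\sim A,C$ infer $\vdash B,C$. - Exchange1: from $\vdash A_1,A_2$ infer $\vdash A_2,A_1$. - Exchange2: from $\vdash A_1,A_2,A_3$ infer $\vdash A_3,A_2,A_1$. - Axiom $\top$: $\vdash\top,A$. - $\&$: from $\vdash A,C$ and $\vdash B,C$ infer $\vdash A\&B,C$. - $\oplus1$: from $\vdash A,C$ infer $\vdash A\oplus B,C$. - $\oplus2$: from $\vdash A,C$ infer $\vdash B\oplus A,C$. - Axiom1: $\vdash\mathbf1$. - $\bot$: from $\vdash A$ infer $\vdash\sim\mathbf1,A$. - $\otimes$: from $\vdash A,C$ and $\vdash B,D$ infer $\vdash C,D,A\otimes B$. - $\wp$: from $\vdash A,B,\sigma$ infer $\vdash A\wp B,\sigma$.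
   Formalization: The side formulas of Cut, &, ⊕1, ⊕2, ⊗ and the formula A in Axiom ⊤ may be absent; if they had to be present, as the rules literally read, ⊢⊤ (and ⊢1⊕1, ⊢1⊗1) would be underivable although 1 always belongs to their interpretations. *)

theory Defs
  imports Main
begin

datatype 'a formula =
    Letter 'a
  | NegLetter 'a
  | One
  | Top
  | NegOne
  | NegTop
  | Tensor "'a formula" "'a formula"
  | Par "'a formula" "'a formula"
  | With "'a formula" "'a formula"
  | Plus "'a formula" "'a formula"

primrec neg :: "'a formula \<Rightarrow> 'a formula" where
  "neg (Letter a) = NegLetter a"
| "neg (NegLetter a) = Letter a"
| "neg One = NegOne"
| "neg Top = NegTop"
| "neg NegOne = One"
| "neg NegTop = Top"
| "neg (Tensor A B) = Par (neg A) (neg B)"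
| "neg (Par A B) = Tensor (neg A) (neg B)"
| "neg (With A B) = Plus (neg A) (neg B)"
| "neg (Plus A B) = With (neg A) (neg B)"

(* Carriers are sets, so that a hypothesis about all Q-structures over one type can
   range over structures of every cardinality up to that of the type. Validity in all
   Q-structures with carrier included in 'a formula suffices for
   completeness: this type has a copy of every structure of cardinality
   at most max(card of 'a, aleph_0). *)
locale q_structure =
  fixes P :: "'p set" and Z :: "'p set" and mult :: "'p \<Rightarrow> 'p \<Rightarrow> 'p" (infixl "\<cdot>" 70) and e :: 'p
  assumes Z_subset: "Z \<subseteq> P"
    and mult_closed: "\<lbrakk>x \<in> P; y \<in> P\<rbrakk> \<Longrightarrow> x \<cdot> y \<in> P"
    and unit_closed: "e \<in> P"
    and Z_commute: "\<lbrakk>x \<in> P; y \<in> P\<rbrakk> \<Longrightarrow> x \<cdot> y \<in> Z \<longleftrightarrow> y \<cdot> x \<in> Z"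
    and Z_assoc: "\<lbrakk>x \<in> P; y \<in> P; z \<in> P\<rbrakk> \<Longrightarrow> (x \<cdot> y) \<cdot> z \<in> Z \<longleftrightarrow> x \<cdot> (z \<cdot> y) \<in> Z"
    and unit_left: "x \<in> P \<Longrightarrow> e \<cdot> x = x"
    and unit_right: "x \<in> P \<Longrightarrow> x \<cdot> e = x"
begin

definition perp :: "'p set \<Rightarrow> 'p set" where
  "perp A = {b \<in> P. \<forall>a\<in>A. b \<cdot> a \<in> Z}"

definition fact :: "'p set \<Rightarrow> bool" where
  "fact F \<longleftrightarrow> F = perp (perp F)"

definition set_mult :: "'p set \<Rightarrow> 'p set \<Rightarrow> 'p set" where
  "set_mult A B = {a \<cdot> b | a b. a \<in> A \<and> b \<in> B}"

definition fact_tensor :: "'p set \<Rightarrow> 'p set \<Rightarrow> 'p set" where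
  "fact_tensor F G = perp (perp (set_mult F G))"

definition fact_par :: "'p set \<Rightarrow> 'p set \<Rightarrow> 'p set" where
  "fact_par F G = perp (set_mult (perp F) (perp G))"

definition fact_with :: "'p set \<Rightarrow> 'p set \<Rightarrow> 'p set" where
  "fact_with F G = F \<inter> G"

definition fact_plus :: "'p set \<Rightarrow> 'p set \<Rightarrow> 'p set" where
  "fact_plus F G = perp (perp (F \<union> G))"

primrec interp :: "('a \<Rightarrow> 'p set) \<Rightarrow> 'a formula \<Rightarrow> 'p set" where
  "interp v (Letter a) = v a"
| "interp v (NegLetter a) = perp (v a)"
| "interp v One = perp Z"
| "interp v Top = P"
| "interp v NegOne = perp (perp Z)"
| "interp v NegTop = perp P"
| "interp v (Tensor A B) = fact_tensor (interp v A) (interp v B)"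
| "interp v (Par A B) = fact_par (interp v A) (interp v B)"
| "interp v (With A B) = fact_with (interp v A) (interp v B)"
| "interp v (Plus A B) = fact_plus (interp v A) (interp v B)"

end

(* The side formulas (the passive B, C, D of a rule, and the A of the axiom for
   Top) are rendered as lists of length at most 1: each may be absent. If they
   were required to be present, every derivable one-formula sequent
   would be One or of the form Par A B, whereas e.g. Top, Plus One One and
   Tensor One One contain the unit in every interpretation. *)
inductive derivable :: "'a formula list \<Rightarrow> bool" where
  ax: "derivable [neg A, A]"
| cut: "\<lbrakk>derivable (A # \<Gamma>); derivable (neg A # \<Delta>); length \<Gamma> \<le> 1; length \<Delta> \<le> 1\<rbrakk>
    \<Longrightarrow> derivable (\<Gamma> @ \<Delta>)"
| exchange1: "derivable [A1, A2] \<Longrightarrow> derivable [A2, A1]"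
| exchange2: "derivable [A1, A2, A3] \<Longrightarrow> derivable [A3, A2, A1]"
| top: "length \<Gamma> \<le> 1 \<Longrightarrow> derivable (Top # \<Gamma>)"
| with_rule: "\<lbrakk>derivable (A # \<Gamma>); derivable (B # \<Gamma>); length \<Gamma> \<le> 1\<rbrakk>
    \<Longrightarrow> derivable (With A B # \<Gamma>)"
| plus1: "\<lbrakk>derivable (A # \<Gamma>); length \<Gamma> \<le> 1\<rbrakk> \<Longrightarrow> derivable (Plus A B # \<Gamma>)"
| plus2: "\<lbrakk>derivable (A # \<Gamma>); length \<Gamma> \<le> 1\<rbrakk> \<Longrightarrow> derivable (Plus B A # \<Gamma>)"
| one: "derivable [One]"
| bot: "derivable [A] \<Longrightarrow> derivable [NegOne, A]"
| tensor: "\<lbrakk>derivable (A # \<Gamma>); derivable (B # \<Delta>); length \<Gamma> \<le> 1; length \<Delta> \<le> 1\<rbrakk>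
    \<Longrightarrow> derivable (\<Gamma> @ \<Delta> @ [Tensor A B])"
| par: "derivable (A # B # \<sigma>) \<Longrightarrow> derivable (Par A B # \<sigma>)"

end

theory Submission
  imports Defs
begin

text \<open>
  The syntactic model has all formulas as elements, with \<open>x \<cdot> y = x \<otimes> y\<close> and \<open>x \<in> Z\<close> iff \<open>\<turnstile> \<sim>x\<close>;
  a formula \<open>A\<close> is interpreted by \<open>{B. \<turnstile> \<sim>B, A}\<close>. The unit laws are made strict by letting the
  formula \<open>1\<close> act as the unit. Residuation yields \<open>1 \<otimes> A \<turnstile> A\<close> but not \<open>A \<otimes> 1 \<turnstile> A\<close>, so the
  formula \<open>1\<close> cannot simply be identified with the unit; as a formula it is still
  present through equivalent ones such as \<open>1 & 1\<close>.

  Since the cut rule admits only one side formula per premise, \<open>\<wp>\<close> is not invertible by a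
  direct cut. What saves the argument is the residuation law
  \<open>\<turnstile> X \<wp> Y, W\<close> iff \<open>\<turnstile> X, W \<wp> Y\<close>, obtained by cutting through \<open>(W \<wp> Y) \<otimes> \<sim>Y\<close>. It is the
  second Q-structure axiom of the model, and with \<open>W = \<sim>1\<close> it inverts \<open>\<wp>\<close>.
\<close>

lemma neg_neg [simp]: "neg (neg A) = A"
  by (induction A) auto

lemma derivable_swap: "derivable [A, B] \<longleftrightarrow> derivable [B, A]"
  using exchange1 by blast

lemma derivable_id: "derivable [A, neg A]"
  by (rule exchange1) (rule ax)

lemma derivable_trans:
  assumes "derivable [A, B]" "derivable [neg B, C]"
  shows "derivable [A, C]"
  using cut[of B "[A]" "[C]", OF exchange1[OF assms(1)] assms(2)] by simp

lemma derivable_NegOne_iff: "derivable [NegOne, A] \<longleftrightarrow> derivable [A]"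
  using cut[of One "[]" "[A]"] one bot[of A] by auto

lemma derivable_Par_Tensor:
  assumes "derivable [A, C]" "derivable [B, D]"
  shows "derivable [Par C D, Tensor A B]" "derivable [Par (Tensor A B) D, C]"
proof -
  have "derivable [C, D, Tensor A B]"
    using tensor[of A "[C]" B "[D]"] assms by simp
  then show "derivable [Par C D, Tensor A B]" "derivable [Par (Tensor A B) D, C]"
    using par exchange2 by blast+
qed

lemma derivable_residuate_imp:
  assumes "derivable [X, Par W Y]"
  shows "derivable [Par X Y, W]"
proof -
  have "derivable [Par X Y, Tensor (Par W Y) (neg Y)]"
    by (rule derivable_Par_Tensor(1)[OF exchange1[OF assms] ax])
  moreover have "derivable [Par (Tensor (neg W) (neg Y)) Y, W]"
    by (rule derivable_Par_Tensor(2)) (rule ax)+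
  ultimately show ?thesis
    using derivable_trans[of "Par X Y" "Tensor (Par W Y) (neg Y)" W] by simp
qed

lemma derivable_residuate: "derivable [Par X Y, W] \<longleftrightarrow> derivable [X, Par W Y]"
  by (metis derivable_residuate_imp derivable_swap)

lemma derivable_Par_iff: "derivable [Par A B] \<longleftrightarrow> derivable [A, B]"
proof
  assume "derivable [Par A B]"
  then have "derivable [A, Par NegOne B]"
    by (metis bot derivable_swap derivable_residuate)
  \<comment> \<open>Tensoring \<open>One\<close>, with no side formula, with an identity lets the
    next cut remove \<open>NegOne\<close>.\<close>
  moreover have "derivable [neg (Par NegOne B), B]"
    using tensor[of One "[]" "neg B" "[B]"] one ax[of B, THEN exchange1]
      ax[of "neg B"] derivable_swap[of B] by simp
  ultimately show "derivable [A, B]"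
    by (rule derivable_trans)
qed (rule par)

definition syn_Z :: "'a formula set" where
  "syn_Z = {A. derivable [neg A]}"

definition syn_mult :: "'a formula \<Rightarrow> 'a formula \<Rightarrow> 'a formula" where
  "syn_mult A B = (if A = One then B else if B = One then A else Tensor A B)"

definition down :: "'a formula \<Rightarrow> 'a formula set" where
  "down A = {B. derivable [neg B, A]}"

text \<open>Inverting \<open>Par\<close> and dropping \<open>NegOne\<close> erase the case
  distinction in \<open>syn_mult\<close>.\<close>

lemma syn_mult_in_syn_Z: "syn_mult A B \<in> syn_Z \<longleftrightarrow> derivable [neg A, neg B]"
  using derivable_swap[of "neg A" NegOne]
  by (auto simp: syn_mult_def syn_Z_def derivable_NegOne_iff derivable_Par_iff)

interpretation syn: q_structure UNIV syn_Z syn_mult One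
proof
  fix x y z :: "'a formula"
  show "syn_mult x y \<in> syn_Z \<longleftrightarrow> syn_mult y x \<in> syn_Z"
    unfolding syn_mult_in_syn_Z by (rule derivable_swap)
  show "syn_mult (syn_mult x y) z \<in> syn_Z \<longleftrightarrow> syn_mult x (syn_mult z y) \<in> syn_Z"
  \<comment> \<open>With \<open>One\<close> present both sides are binary products, equal up to a
    swap.\<close>
  proof (cases "One \<in> {x, y, z}")
    case True
    then show ?thesis
      using derivable_swap[of "neg y" "neg z"] syn_mult_in_syn_Z[of y z] syn_mult_in_syn_Z[of z y]
      by (auto simp: syn_mult_def)
  next
    case False
    then have "syn_mult x y = Tensor x y" "syn_mult z y = Tensor z y"
      by (auto simp: syn_mult_def)
    then show ?thesis
      using derivable_residuate[of "neg x" "neg y" "neg z"] by (simp add: syn_mult_in_syn_Z)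
  qed
qed (auto simp: syn_mult_def)

lemma syn_perp: "syn.perp S = {B. \<forall>A\<in>S. derivable [neg B, neg A]}"
  by (simp add: syn.perp_def syn_mult_in_syn_Z)

text \<open>\<open>A\<close> is the greatest element of \<open>down A\<close>, so orthogonality to
  \<open>A\<close> alone decides; cut extends it to the rest.\<close>

lemma perp_down: "syn.perp (down A) = down (neg A)"
proof (intro equalityI subsetI)
  fix B assume "B \<in> syn.perp (down A)"
  then show "B \<in> down (neg A)"
    using ax[of A] by (auto simp: syn_perp down_def)
next
  fix B assume "B \<in> down (neg A)"
  then show "B \<in> syn.perp (down A)"
    using derivable_trans[of "neg B" "neg A"] derivable_swap by (fastforce simp: syn_perp down_def)
qed

lemma fact_down: "syn.fact (down A)"
  by (simp add: syn.fact_def perp_down)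

lemma perp_syn_Z: "syn.perp syn_Z = down One"
proof (intro equalityI subsetI)
  fix B assume "B \<in> syn.perp syn_Z"
  \<comment> \<open>By \<open>bot\<close>, \<open>NegOne\<close> is the greatest element of
    \<open>syn_Z\<close>, so testing against it suffices.\<close>
  moreover have "NegOne \<in> syn_Z"
    by (simp add: syn_Z_def one)
  ultimately show "B \<in> down One"
    by (auto simp: syn_perp down_def)
next
  fix B assume "B \<in> down One"
  then show "B \<in> syn.perp syn_Z"
    using derivable_trans[of "neg B" One] bot
    by (force simp: syn_perp down_def dest: syn_Z_def[THEN equalityD1, THEN subsetD])
qed

lemma down_Top: "down Top = UNIV"
  using top[of "[A]" for A] derivable_swap by (auto simp: down_def)

text \<open>If \<open>a\<close> is \<open>One\<close>, then \<open>A\<close> is derivable alone, so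
  the tensor rule applies with that side formula absent; likewise for \<open>b\<close>.\<close>

lemma derivable_syn_mult_Tensor:
  assumes "a \<in> down A" "b \<in> down B"
  shows "derivable [neg (syn_mult a b), Tensor A B]"
proof -
  have a: "derivable [A, neg a]" and b: "derivable [B, neg b]"
    using assms derivable_swap[of A] derivable_swap[of B] by (simp_all add: down_def)
  have One_D: "derivable [C]" if "derivable [C, neg One]" for C :: "'a formula"
    using that derivable_swap[of C NegOne] derivable_NegOne_iff[of C] by simp
  consider "a = One" "b = One" | "a = One" "b \<noteq> One" | "a \<noteq> One" "b = One" | "a \<noteq> One" "b \<noteq> One"
    by blast
  then show ?thesis
  proof cases
    case 1
    then have "derivable [Tensor A B]"
      using tensor[of A "[]" B "[]"] a b One_D by auto
    then show ?thesis
      using 1 by (simp add: syn_mult_def derivable_NegOne_iff)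
  next
    case 2
    then show ?thesis
      using tensor[of A "[]" B "[neg b]"] a b One_D by (auto simp: syn_mult_def)
  next
    case 3
    then show ?thesis
      using tensor[of A "[neg a]" B "[]"] a b One_D by (auto simp: syn_mult_def)
  next
    case 4
    then show ?thesis
      using derivable_Par_Tensor(1)[OF a b] by (simp add: syn_mult_def)
  qed
qed

lemma perp_UNIV: "syn.perp UNIV = down NegTop"
  using perp_down[of Top] by (simp add: down_Top)

lemma perp_set_mult_down:
  "syn.perp (syn.set_mult (down A) (down B)) = down (Par (neg A) (neg B))"
proof (intro equalityI subsetI)
  fix C assume C: "C \<in> syn.perp (syn.set_mult (down A) (down B))"
  \<comment> \<open>\<open>A & A\<close> and \<open>B & B\<close> are copies of \<open>A\<close> and \<open>B\<close> that differ from \<open>One\<close>, so that their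
      product is not collapsed.\<close>
  have "With A A \<in> down A" "With B B \<in> down B"
    using plus1[OF ax[of A]] plus1[OF ax[of B]] by (simp_all add: down_def)
  then have "Tensor (With A A) (With B B) \<in> syn.set_mult (down A) (down B)"
    by (force simp: syn.set_mult_def syn_mult_def)
  then have "derivable [neg C, neg (Tensor (With A A) (With B B))]"
    using C unfolding syn_perp by blast
  moreover have "derivable [Tensor (With A A) (With B B), Par (neg A) (neg B)]"
    using derivable_id[of A] derivable_id[of B]
    by (metis One_nat_def derivable_Par_Tensor(1) exchange1 length_Cons list.size(3) order_refl
        with_rule)
  ultimately show "C \<in> down (Par (neg A) (neg B))"
    using derivable_trans[of "neg C" "neg (Tensor (With A A) (With B B))"] by (simp add: down_def)
next
  fix C assume C: "C \<in> down (Par (neg A) (neg B))"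
  have "derivable [neg C, neg (syn_mult a b)]" if "a \<in> down A" "b \<in> down B" for a b
    using derivable_trans[of "neg C" "Par (neg A) (neg B)" "neg (syn_mult a b)"] C
      exchange1[OF derivable_syn_mult_Tensor[OF that]]
    by (simp add: down_def)
  then show "C \<in> syn.perp (syn.set_mult (down A) (down B))"
    by (auto simp: syn_perp syn.set_mult_def)
qed

lemma down_With: "down (With A B) = down A \<inter> down B"
proof (intro equalityI subsetI)
  fix C assume C: "C \<in> down (With A B)"
  have "derivable [neg (With A B), A]" "derivable [neg (With A B), B]"
    using plus1[OF ax] plus2[OF ax] by auto
  then show "C \<in> down A \<inter> down B"
    using C derivable_trans unfolding down_def by blast
next
  fix C assume "C \<in> down A \<inter> down B"
  then show "C \<in> down (With A B)"
    using with_rule[of A "[neg C]" B] derivable_swap by (auto simp: down_def)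
qed

text \<open>A further \<open>perp\<close> turns the right side into
  \<open>down (Plus A B)\<close>.\<close>

lemma perp_down_Un: "syn.perp (down A \<union> down B) = down (With (neg A) (neg B))"
proof -
  have "syn.perp (down A \<union> down B) = syn.perp (down A) \<inter> syn.perp (down B)"
    by (auto simp: syn_perp)
  then show ?thesis
    by (simp add: perp_down down_With)
qed

lemma interp_down: "syn.interp (\<lambda>a. down (Letter a)) A = down A"
  by (induction A)
    (simp_all add: perp_down perp_syn_Z down_Top perp_UNIV syn.fact_tensor_def syn.fact_par_def
      syn.fact_with_def syn.fact_plus_def perp_set_mult_down down_With[symmetric] perp_down_Un)

theorem theorem2:
  fixes x :: "'a formula"
  assumes "\<And>(P :: 'a formula set) Z mult e (v :: 'a \<Rightarrow> 'a formula set).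
      \<lbrakk>q_structure P Z mult e; \<And>a. q_structure.fact P Z mult (v a)\<rbrakk>
        \<Longrightarrow> e \<in> q_structure.interp P Z mult v x"
  shows "derivable [x]"
proof -
  have "One \<in> syn.interp (\<lambda>a. down (Letter a)) x"
    by (rule assms) (rule syn.q_structure_axioms fact_down)+
  then show ?thesis
    unfolding interp_down by (simp add: down_def derivable_NegOne_iff)
qed

end
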